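(* There is an algorithm that, given a graph $G$ with $n$ vertices and $m$ edges, lists all avoidable vertices of $G$ in $O(n^2 m)$ time.
   Context: All graphs are finite, simple and undirected. A vertex $v$ of a graph $G$ is avoidable if every induced path on three vertices with middle vertex $v$ is contained in an induced cycle of $G$.
   Formalization: The time bound O(n^2 m) is claimed only for graphs with at least one edge, since for m = 0 it would be zero although all n vertices must be listed; for edgeless graphs only termination with the correct list is claimed. *)

theory Defs
  imports Main
begin

definition simple_graph :: "'a set \<Rightarrow> 'a set set \<Rightarrow> bool" where
  "simple_graph V E \<longleftrightarrow> finite V \<and> (\<forall>e\<in>E. e \<subseteq> V \<and> card e = 2)"

definition induced_edges :: "'a set set \<Rightarrow> 'a set \<Rightarrow> 'a set set" where
  "induced_edges E S = {e \<in> E. e \<subseteq> S}"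

definition path_edges :: "'a list \<Rightarrow> 'a set set" where
  "path_edges ps = {{ps ! i, ps ! Suc i} | i. Suc i < length ps}"

definition cycle_edges :: "'a list \<Rightarrow> 'a set set" where
  "cycle_edges cs = {{cs ! i, cs ! (Suc i mod length cs)} | i. i < length cs}"

definition induced_path :: "'a set \<Rightarrow> 'a set set \<Rightarrow> 'a list \<Rightarrow> bool" where
  "induced_path V E ps \<longleftrightarrow>
     ps \<noteq> [] \<and> distinct ps \<and> set ps \<subseteq> V \<and> induced_edges E (set ps) = path_edges ps"

definition induced_cycle :: "'a set \<Rightarrow> 'a set set \<Rightarrow> 'a list \<Rightarrow> bool" where
  "induced_cycle V E cs \<longleftrightarrow>
     3 \<le> length cs \<and> distinct cs \<and> set cs \<subseteq> V \<and> induced_edges E (set cs) = cycle_edges cs"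

definition avoidable :: "'a set \<Rightarrow> 'a set set \<Rightarrow> 'a \<Rightarrow> bool" where
  "avoidable V E v \<longleftrightarrow> v \<in> V \<and>
     (\<forall>x y. induced_path V E [x, v, y] \<longrightarrow>
        (\<exists>cs. induced_cycle V E cs \<and> set [x, v, y] \<subseteq> set cs \<and>
              path_edges [x, v, y] \<subseteq> cycle_edges cs))"


text \<open>
  The model of computation is a word RAM, programmed in a structured language. A program has
  finitely many registers (a register is addressed only by a constant in the program text), a
  random access memory, and a write-only output list. Arithmetic is modulo the parameter
  \<open>W\<close>, which is \<open>2 ^ w\<close> for word length \<open>w\<close>, except that subtraction is cut off at 0.
\<close>

record state =
  regs :: "nat \<Rightarrow> nat"
  mem :: "nat \<Rightarrow> nat"
  outp :: "nat list"

datatype aexp = Lit nat | Reg nat | Mem aexp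
  | Plus aexp aexp | Minus aexp aexp | Times aexp aexp

datatype bexp = Less aexp aexp | Eq aexp aexp | Not bexp | And bexp bexp

datatype com = Skip
  | SetReg nat aexp
  | SetMem aexp aexp
  | Output aexp
  | Seq com com
  | If bexp com com
  | While bexp com

fun aval :: "nat \<Rightarrow> aexp \<Rightarrow> state \<Rightarrow> nat" where
  "aval W (Lit c) s = c mod W"
| "aval W (Reg r) s = regs s r"
| "aval W (Mem a) s = mem s (aval W a s)"
| "aval W (Plus a b) s = (aval W a s + aval W b s) mod W"
| "aval W (Minus a b) s = aval W a s - aval W b s"
| "aval W (Times a b) s = (aval W a s * aval W b s) mod W"

fun bval :: "nat \<Rightarrow> bexp \<Rightarrow> state \<Rightarrow> bool" where
  "bval W (Less a b) s = (aval W a s < aval W b s)"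
| "bval W (Eq a b) s = (aval W a s = aval W b s)"
| "bval W (Not b) s = (\<not> bval W b s)"
| "bval W (And b c) s = (bval W b s \<and> bval W c s)"

text \<open>
  Every operation inside an expression costs one unit of time, and so does every executed command
  and every evaluation of a branching condition.
\<close>

fun acost :: "aexp \<Rightarrow> nat" where
  "acost (Lit c) = 1"
| "acost (Reg r) = 1"
| "acost (Mem a) = 1 + acost a"
| "acost (Plus a b) = 1 + acost a + acost b"
| "acost (Minus a b) = 1 + acost a + acost b"
| "acost (Times a b) = 1 + acost a + acost b"

fun bcost :: "bexp \<Rightarrow> nat" where
  "bcost (Less a b) = 1 + acost a + acost b"
| "bcost (Eq a b) = 1 + acost a + acost b"
| "bcost (Not b) = 1 + bcost b"
| "bcost (And b c) = 1 + bcost b + bcost c"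

text \<open>
  \<open>exec W p s t s'\<close>: started in state \<open>s\<close>, program \<open>p\<close> halts in state \<open>s'\<close> after time \<open>t\<close>.
\<close>

inductive exec :: "nat \<Rightarrow> com \<Rightarrow> state \<Rightarrow> nat \<Rightarrow> state \<Rightarrow> bool" for W :: nat where
  Skip: "exec W Skip s 1 s"
| SetReg: "exec W (SetReg r a) s (1 + acost a) (s\<lparr>regs := (regs s)(r := aval W a s)\<rparr>)"
| SetMem: "exec W (SetMem a b) s (1 + acost a + acost b)
             (s\<lparr>mem := (mem s)(aval W a s := aval W b s)\<rparr>)"
| Output: "exec W (Output a) s (1 + acost a) (s\<lparr>outp := outp s @ [aval W a s]\<rparr>)"
| Seq: "exec W p s t s' \<Longrightarrow> exec W q s' t' s'' \<Longrightarrow> exec W (Seq p q) s (t + t') s''"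
| IfTrue: "bval W b s \<Longrightarrow> exec W p s t s' \<Longrightarrow> exec W (If b p q) s (1 + bcost b + t) s'"
| IfFalse: "\<not> bval W b s \<Longrightarrow> exec W q s t s' \<Longrightarrow> exec W (If b p q) s (1 + bcost b + t) s'"
| WhileFalse: "\<not> bval W b s \<Longrightarrow> exec W (While b p) s (1 + bcost b) s"
| WhileTrue: "bval W b s \<Longrightarrow> exec W p s t s' \<Longrightarrow> exec W (While b p) s' t' s'' \<Longrightarrow>
     exec W (While b p) s (1 + bcost b + t + t') s''"

inductive_cases exec_SkipE: "exec W Skip s t s'"
  and exec_SetRegE: "exec W (SetReg r a) s t s'"
  and exec_SetMemE: "exec W (SetMem a b) s t s'"
  and exec_OutputE: "exec W (Output a) s t s'"
  and exec_SeqE: "exec W (Seq p q) s t s'"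
  and exec_IfE: "exec W (If b p q) s t s'"
  and exec_WhileE: "exec W (While b p) s t s'"

lemma exec_deterministic:
  "exec W p s t s' \<Longrightarrow> exec W p s u s'' \<Longrightarrow> u = t \<and> s'' = s'"
proof (induction arbitrary: u s'' rule: exec.induct)
  case (Skip s) then show ?case by (rule exec_SkipE) simp
next
  case (SetReg r a s) then show ?case by (rule exec_SetRegE) simp
next
  case (SetMem a b s) then show ?case by (rule exec_SetMemE) simp
next
  case (Output a s) then show ?case by (rule exec_OutputE) simp
next
  case (Seq p s t s' q t' s1)
  from Seq.prems show ?case
    by (rule exec_SeqE) (metis Seq.IH)
next
  case (IfTrue b s p t s' q)
  from IfTrue.prems show ?case
    by (rule exec_IfE) (metis IfTrue.IH IfTrue.hyps(1) plus_1_eq_Suc add_Suc)+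
next
  case (IfFalse b s q t s' p)
  from IfFalse.prems show ?case
    by (rule exec_IfE) (metis IfFalse.IH IfFalse.hyps(1) plus_1_eq_Suc add_Suc)+
next
  case (WhileFalse b s p)
  from WhileFalse.prems show ?case
    by (rule exec_WhileE) (simp_all add: WhileFalse.hyps)
next
  case (WhileTrue b s p t s' t' s1)
  from WhileTrue.prems show ?case
    by (rule exec_WhileE) (metis WhileTrue.IH WhileTrue.hyps(1) plus_1_eq_Suc add_Suc)+
qed

text \<open>
  A graph with vertex set \<open>{..<n}\<close> is presented by \<open>n\<close> in register 0 and by its adjacency matrix,
  stored row by row, in the memory cells below \<open>n * n\<close>; everything else is 0.
\<close>

definition input_state :: "nat \<Rightarrow> nat set set \<Rightarrow> state" where
  "input_state n E =
     \<lparr>regs = (\<lambda>r. if r = 0 then n else 0),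
      mem = (\<lambda>a. if a < n * n \<and> {a div n, a mod n} \<in> E then 1 else 0),
      outp = []\<rparr>"

end

theory Submission imports Defs begin

text \<open>
  Let \<open>x\<close> and \<open>y\<close> be two nonadjacent neighbours of \<open>v\<close>. The path \<open>x, v, y\<close> lies on an induced cycle
  iff \<open>y\<close> can be reached from \<open>x\<close> by a path whose inner vertices are outside the closed neighbourhood
  of \<open>v\<close>: a shortest such path together with \<open>v\<close> is an induced cycle. For adjacent neighbours such a
  path trivially exists, so \<open>v\<close> is avoidable iff, for each neighbour \<open>x\<close> of \<open>v\<close>, a graph search from
  \<open>x\<close> that expands only \<open>x\<close> and vertices outside the closed neighbourhood of \<open>v\<close> meets all neighbours
  of \<open>v\<close>. On an adjacency matrix one search takes time \<open>O(n\<^sup>2)\<close>, and there are \<open>2 m\<close> pairs \<open>(v, x)\<close>.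
\<close>

subsection \<open>Avoidable vertices and reachability\<close>

text \<open>The condition on \<open>u\<close> says which vertices may be expanded; the reached
  vertex \<open>z\<close> may be a neighbour of \<open>v\<close>. Without
  \<open>z \<noteq> v\<close> the vertex \<open>v\<close> itself could be reached and, since
  \<open>{v, v}\<close> is not an edge of a simple graph, also expanded.\<close>

inductive reach :: "'a set set \<Rightarrow> 'a \<Rightarrow> 'a \<Rightarrow> 'a \<Rightarrow> bool" for E v x where
  start: "reach E v x x"
| step: "reach E v x u \<Longrightarrow> u = x \<or> {v, u} \<notin> E \<Longrightarrow> {u, z} \<in> E \<Longrightarrow> z \<noteq> v \<Longrightarrow> reach E v x z"

section \<open>Edges of paths and cycles given as lists\<close>

lemma path_edges_Nil [simp]: "path_edges [] = {}"
  and path_edges_single [simp]: "path_edges [a] = {}"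
  by (auto simp: path_edges_def)

lemma path_edges_Cons2 [simp]:
  "path_edges (a # b # ps) = insert {a, b} (path_edges (b # ps))"
proof -
  have ex_nat: "(\<exists>i. P i) \<longleftrightarrow> P 0 \<or> (\<exists>i. P (Suc i))" for P :: "nat \<Rightarrow> bool"
    by (metis not0_implies_Suc)
  have "e \<in> path_edges (a # b # ps) \<longleftrightarrow> e = {a, b} \<or> e \<in> path_edges (b # ps)" for e
  proof -
    have "e \<in> path_edges (a # b # ps) \<longleftrightarrow>
        (\<exists>i. Suc i < length (a # b # ps) \<and> e = {(a # b # ps) ! i, (a # b # ps) ! Suc i})"
      by (auto simp: path_edges_def)
    also have "\<dots> \<longleftrightarrow> e = {a, b} \<or>
        (\<exists>i. Suc i < length (b # ps) \<and> e = {(b # ps) ! i, (b # ps) ! Suc i})"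
      by (subst ex_nat) auto
    finally show ?thesis by (auto simp: path_edges_def)
  qed
  then show ?thesis by blast
qed

lemma path_edges_append:
  "path_edges (xs @ a # ys) = path_edges (xs @ [a]) \<union> path_edges (a # ys)"
proof (induction xs)
  case (Cons b xs)
  then show ?case by (cases xs) auto
qed simp

lemma path_edges_rev: "path_edges (rev ps) = path_edges ps"
proof (induction ps)
  case (Cons a ps)
  then show ?case
    by (cases ps) (auto simp: path_edges_append[of _ _ "[a]"] insert_commute)
qed simp

lemma path_edges_subset_set: "e \<in> path_edges ps \<Longrightarrow> e \<subseteq> set ps"
  by (auto simp: path_edges_def)

text \<open>Unrolling the cycle into a closed walk removes the index modulo the length, so that
  facts on path edges apply to cycles.\<close>

lemma cycle_edges_Cons: "cycle_edges (a # ps) = path_edges (a # ps @ [a])"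
proof -
  have "(a # ps) ! i = (a # ps @ [a]) ! i \<and>
      (a # ps) ! (Suc i mod length (a # ps)) = (a # ps @ [a]) ! Suc i"
    if "i < length (a # ps)" for i
    using that by (cases "i = length ps") (auto simp: nth_append nth_Cons')
  then have "(e = {(a # ps) ! i, (a # ps) ! (Suc i mod length (a # ps))} \<and> i < length (a # ps)) \<longleftrightarrow>
      (e = {(a # ps @ [a]) ! i, (a # ps @ [a]) ! Suc i} \<and> Suc i < length (a # ps @ [a]))" for e i
    by (metis Suc_less_eq append_Cons length_append_singleton)
  then show ?thesis unfolding cycle_edges_def path_edges_def by presburger
qed

lemma cycle_edges_rotate1: "cycle_edges (rotate1 cs) = cycle_edges cs"
proof (cases cs)
  case (Cons a ps)
  show ?thesis
  proof (cases ps)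
    case (Cons b qs)
    then show ?thesis
      using \<open>cs = a # ps\<close> path_edges_append[of "b # qs" a "[b]"]
      by (auto simp: cycle_edges_Cons)
  qed (simp add: \<open>cs = a # ps\<close>)
qed simp

lemma cycle_edges_rotate: "cycle_edges (rotate k cs) = cycle_edges cs"
  by (induction k) (auto simp: cycle_edges_rotate1)

lemma induced_cycle_rotate: "induced_cycle V E (rotate k cs) = induced_cycle V E cs"
  by (simp add: induced_cycle_def cycle_edges_rotate)

lemma rotate_to_front:
  assumes "v \<in> set cs"
  obtains k ps where "rotate k cs = v # ps"
proof -
  obtain xs ys where "cs = xs @ v # ys" using assms by (meson split_list)
  then have "rotate (length xs) cs = v # ys @ xs" by (simp add: rotate_append)
  then show ?thesis using that by blast
qed

section \<open>Reachability around a vertex and induced cycles through it\<close>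

lemma reach_along_path:
  assumes "ps \<noteq> []" "path_edges ps \<subseteq> E" "v \<notin> set ps" "distinct ps"
    and "\<And>u. u \<in> set ps \<Longrightarrow> {v, u} \<in> E \<Longrightarrow> u = hd ps \<or> u = last ps"
  shows "reach E v (hd ps) (last ps)"
proof -
  have "reach E v (hd ps) (ps ! i)" if "i < length ps" for i
    using that
  proof (induction i)
    case 0
    then show ?case by (simp add: hd_conv_nth[symmetric] reach.start)
  next
    case (Suc i)
    have "{ps ! i, ps ! Suc i} \<in> E" using Suc.prems assms(2) by (auto simp: path_edges_def)
    moreover have "ps ! Suc i \<noteq> v" using Suc.prems assms(3) nth_mem by metis
    \<comment> \<open>Distinctness rules out the last vertex at an earlier position, so
      \<open>ps ! i\<close> is the start or not adjacent to \<open>v\<close>, and may be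
      expanded.\<close>
    moreover have "ps ! i \<noteq> last ps"
      using Suc.prems assms(1,4) by (simp add: last_conv_nth nth_eq_iff_index_eq)
    then have "ps ! i = hd ps \<or> {v, ps ! i} \<notin> E"
      using assms(5)[of "ps ! i"] Suc.prems by auto
    ultimately show ?case using Suc by (auto intro: reach.step)
  qed
  from this[of "length ps - 1"] show ?thesis
    using assms(1) by (simp add: last_conv_nth)
qed

text \<open>The list may still repeat vertices. Its last vertex \<open>u\<close> becomes an inner
  one when \<open>z\<close> is appended, which is harmless because an expanded vertex is
  \<open>x\<close> or not adjacent to \<open>v\<close>.\<close>

lemma reach_imp_path:
  assumes "reach E v x y" "x \<noteq> v"
  shows "\<exists>ps. ps \<noteq> [] \<and> hd ps = x \<and> last ps = y \<and> path_edges ps \<subseteq> E \<and> v \<notin> set ps \<and>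
    (\<forall>u\<in>set ps. {v, u} \<in> E \<longrightarrow> u = x \<or> u = y)"
  using assms
proof (induction)
  case start
  then show ?case by (intro exI[of _ "[x]"]) auto
next
  case (step u z)
  then obtain ps where ps: "ps \<noteq> []" "hd ps = x" "last ps = u" "path_edges ps \<subseteq> E" "v \<notin> set ps"
    "\<forall>w\<in>set ps. {v, w} \<in> E \<longrightarrow> w = x \<or> w = u" by blast
  obtain qs where qs: "ps = qs @ [u]" using ps(1,3) by (metis append_butlast_last_id)
  show ?case
  proof (intro exI[of _ "ps @ [z]"] conjI)
    show "hd (ps @ [z]) = x" using ps by simp
    show "path_edges (ps @ [z]) \<subseteq> E"
      using ps step qs path_edges_append[of qs u "[z]"] by auto
    show "\<forall>w\<in>set (ps @ [z]). {v, w} \<in> E \<longrightarrow> w = x \<or> w = z" using ps step by auto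
  qed (use ps step in auto)
qed

text \<open>A shortest list as in \<open>reach_imp_path\<close> works: a repeated vertex or a chord
  would allow a segment to be cut out, and the shorter list would still have the same ends, edges in
  \<open>E\<close> and no new vertices.\<close>

lemma reach_imp_induced_path:
  assumes "reach E v x y" "x \<noteq> v"
  shows "\<exists>ps. ps \<noteq> [] \<and> hd ps = x \<and> last ps = y \<and> path_edges ps \<subseteq> E \<and> v \<notin> set ps \<and>
    (\<forall>u\<in>set ps. {v, u} \<in> E \<longrightarrow> u = x \<or> u = y) \<and> distinct ps \<and>
    (\<forall>i j. i < j \<longrightarrow> j < length ps \<longrightarrow> {ps ! i, ps ! j} \<in> E \<longrightarrow> j = Suc i)"
proof -
  define P where "P = (\<lambda>ps. ps \<noteq> [] \<and> hd ps = x \<and> last ps = y \<and> path_edges ps \<subseteq> E \<and> v \<notin> set ps \<and>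
    (\<forall>u\<in>set ps. {v, u} \<in> E \<longrightarrow> u = x \<or> u = y))"
  obtain ps0 where "P ps0" using reach_imp_path[OF assms] unfolding P_def by blast
  then obtain ps where "P ps" and min: "\<And>qs. P qs \<Longrightarrow> length ps \<le> length qs"
    using ex_has_least_nat[of P ps0 length] by blast
  then have ps: "ps \<noteq> []" "hd ps = x" "last ps = y" "path_edges ps \<subseteq> E" "v \<notin> set ps"
    "\<forall>u\<in>set ps. {v, u} \<in> E \<longrightarrow> u = x \<or> u = y" by (auto simp: P_def)
  have split: "path_edges ps = path_edges (take i ps @ [ps ! i]) \<union> path_edges (ps ! i # drop (Suc i) ps)"
    if "i < length ps" for i
    using that by (metis id_take_nth_drop path_edges_append)
  have take_edges: "path_edges (take i ps @ [ps ! i]) \<subseteq> E" if "i < length ps" for i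
    using split[OF that] ps(4) by blast
  have drop_edges: "path_edges (ps ! j # drop (Suc j) ps) \<subseteq> E" if "j < length ps" for j
    using split[OF that] ps(4) by blast
  have last_drop: "last (ps ! j # drop (Suc j) ps) = y" if "j < length ps" for j
    using that ps by (simp add: Cons_nth_drop_Suc)
  have hd_take: "hd (take i ps @ ps ! i # zs) = x" if "i < length ps" for i zs
    using that ps by (cases ps; cases i) auto
  have sub: "set (take i ps) \<subseteq> set ps" "set (drop i ps) \<subseteq> set ps" for i
    by (auto dest: in_set_takeD in_set_dropD)
  have dist: "ps ! i \<noteq> ps ! j" if "i < j" "j < length ps" for i j
  proof
    assume eq: "ps ! i = ps ! j"
    let ?qs = "take i ps @ ps ! i # drop (Suc j) ps"
    have "path_edges ?qs \<subseteq> E"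
      using take_edges[of i] drop_edges[of j] that eq
        path_edges_append[of "take i ps" "ps ! i" "drop (Suc j) ps"] by auto
    moreover have "set ?qs \<subseteq> set ps" using sub[of i] sub[of "Suc j"] that by auto
    moreover have "last ?qs = y" using last_drop[of j] that eq by simp
    moreover have "hd ?qs = x" using hd_take[of i] that by simp
    ultimately have "P ?qs" using ps unfolding P_def by blast
    from min[OF this] show False using that by simp
  qed
  have chord: "j = Suc i" if "i < j" "j < length ps" "{ps ! i, ps ! j} \<in> E" for i j
  proof (rule ccontr)
    \<comment> \<open>Jumping along the chord saves \<open>j - i - 1\<close> vertices, which is
      positive exactly because the chord is not an edge between consecutive positions.\<close>
    assume neq: "j \<noteq> Suc i"
    let ?qs = "take i ps @ ps ! i # ps ! j # drop (Suc j) ps"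
    have "path_edges ?qs \<subseteq> E"
      using take_edges[of i] drop_edges[of j] that
        path_edges_append[of "take i ps" "ps ! i" "ps ! j # drop (Suc j) ps"] by auto
    moreover have "set ?qs \<subseteq> set ps" using sub[of i] sub[of "Suc j"] that by auto
    moreover have "last ?qs = y" using last_drop[of j] that by simp
    moreover have "hd ?qs = x" using hd_take[of i] that by simp
    ultimately have "P ?qs" using ps unfolding P_def by blast
    from min[OF this] show False using that neq by simp
  qed
  have "distinct ps" unfolding distinct_conv_nth using dist by (metis nat_neq_iff)
  with ps chord show ?thesis by blast
qed

lemma simple_graph_edgeD:
  assumes "simple_graph V E" "{a, b} \<in> E"
  shows "a \<in> V" "b \<in> V" "a \<noteq> b"
  using assms by (auto simp: simple_graph_def)

lemma induced_path3_iff: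
  assumes "simple_graph V E"
  shows "induced_path V E [x, v, y] \<longleftrightarrow> {v, x} \<in> E \<and> {v, y} \<in> E \<and> x \<noteq> y \<and> {x, y} \<notin> E"
proof
  assume "induced_path V E [x, v, y]"
  then have *: "distinct [x, v, y]" and ind: "induced_edges E {x, v, y} = {{x, v}, {v, y}}"
    by (simp_all add: induced_path_def)
  have "{x, v} \<in> induced_edges E {x, v, y}" "{v, y} \<in> induced_edges E {x, v, y}"
    unfolding ind by simp_all
  then have "{x, v} \<in> E" "{v, y} \<in> E" by (simp_all add: induced_edges_def)
  moreover have "{x, y} \<notin> E"
  proof
    assume "{x, y} \<in> E"
    then have "{x, y} \<in> induced_edges E {x, v, y}" by (simp add: induced_edges_def)
    then show False using * unfolding ind by (auto simp: doubleton_eq_iff)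
  qed
  ultimately show "{v, x} \<in> E \<and> {v, y} \<in> E \<and> x \<noteq> y \<and> {x, y} \<notin> E"
    using * by (simp add: insert_commute)
next
  assume *: "{v, x} \<in> E \<and> {v, y} \<in> E \<and> x \<noteq> y \<and> {x, y} \<notin> E"
  have mem: "x \<in> V" "v \<in> V" "y \<in> V" "v \<noteq> x" "v \<noteq> y"
    using * simple_graph_edgeD[OF assms] by blast+
  have "e = {x, v} \<or> e = {v, y}" if "e \<in> E" "e \<subseteq> {x, v, y}" for e
  proof -
    obtain a b where "e = {a, b}" "a \<noteq> b"
      using assms \<open>e \<in> E\<close> by (metis simple_graph_def card_2_iff)
    then show ?thesis using that * by (auto simp: doubleton_eq_iff insert_commute)
  qed
  moreover have "{x, v} \<in> E" "{v, y} \<in> E" using * by (simp_all add: insert_commute)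
  ultimately have "induced_edges E {x, v, y} = {{x, v}, {v, y}}"
    unfolding induced_edges_def by blast
  then show "induced_path V E [x, v, y]" using * mem by (simp add: induced_path_def)
qed

text \<open>The cycle is \<open>v\<close> followed by a chordless path from \<open>x\<close> to
  \<open>y\<close>: among the vertices of that path only \<open>x\<close> and \<open>y\<close> are
  adjacent to \<open>v\<close>. If \<open>x\<close> and \<open>y\<close> are adjacent, this yields a
  triangle.\<close>

lemma reach_imp_induced_cycle:
  assumes G: "simple_graph V E" and x: "{v, x} \<in> E" and y: "{v, y} \<in> E" and "x \<noteq> y"
    and "reach E v x y"
  shows "\<exists>cs. induced_cycle V E cs \<and> {x, v, y} \<subseteq> set cs \<and> path_edges [x, v, y] \<subseteq> cycle_edges cs"
proof -
  have neq: "x \<noteq> v" "y \<noteq> v" using simple_graph_edgeD[OF G] x y by blast+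
  obtain ps where ps: "ps \<noteq> []" "hd ps = x" "last ps = y" "path_edges ps \<subseteq> E" "v \<notin> set ps"
    "\<And>u. u \<in> set ps \<Longrightarrow> {v, u} \<in> E \<Longrightarrow> u = x \<or> u = y" "distinct ps"
    and chord: "\<And>i j. i < j \<Longrightarrow> j < length ps \<Longrightarrow> {ps ! i, ps ! j} \<in> E \<Longrightarrow> j = Suc i"
    using reach_imp_induced_path[OF \<open>reach E v x y\<close> neq(1)] by blast
  obtain qs where qs: "ps = qs @ [y]" using ps(1,3) by (metis append_butlast_last_id)
  obtain rs where rs: "ps = x # rs" using ps(1,2) by (cases ps) auto
  have "cycle_edges (v # ps) = insert {v, x} (path_edges (ps @ [v]))"
    using rs by (simp add: cycle_edges_Cons)
  also have "path_edges (ps @ [v]) = insert {v, y} (path_edges ps)"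
    using qs path_edges_append[of qs y "[v]"] by (auto simp: insert_commute)
  finally have ce: "cycle_edges (v # ps) = {{v, x}, {v, y}} \<union> path_edges ps" by auto
  have xy: "x \<in> set ps" "y \<in> set ps" using ps(1-3) by auto
  have "2 \<le> length ps" using ps(2,3) rs \<open>x \<noteq> y\<close> by (cases rs) auto
  have "e \<in> cycle_edges (v # ps)" if e: "e \<in> E" "e \<subseteq> set (v # ps)" for e
  proof -
    obtain a b where ab: "e = {a, b}" "a \<noteq> b"
      using G \<open>e \<in> E\<close> by (metis simple_graph_def card_2_iff)
    consider "a = v" | "b = v" | "a \<noteq> v" "b \<noteq> v" by blast
    then show ?thesis
    proof cases
      case 1
      then have "b = x \<or> b = y" using ps(6)[of b] ab e by auto
      then show ?thesis using 1 ab ce by auto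
    next
      case 2
      then have "a = x \<or> a = y" using ps(6)[of a] ab e by (auto simp: insert_commute)
      then show ?thesis using 2 ab ce by (auto simp: insert_commute)
    next
      case 3
      then obtain i j where ij: "i < length ps" "a = ps ! i" "j < length ps" "b = ps ! j"
        using ab e by (auto simp: in_set_conv_nth)
      then have "i < j \<or> j < i" using ab by (metis nat_neq_iff)
      then have "j = Suc i \<or> i = Suc j"
        using chord[of i j] chord[of j i] ij ab e by (auto simp: insert_commute)
      then have "e \<in> path_edges ps"
        using ij ab by (auto simp: path_edges_def insert_commute)
      then show ?thesis using ce by auto
    qed
  qed
  moreover have "e \<in> E \<and> e \<subseteq> set (v # ps)" if "e \<in> cycle_edges (v # ps)" for e
    using that ce x y ps(4) xy path_edges_subset_set[of e ps] by auto
  ultimately have "induced_edges E (set (v # ps)) = cycle_edges (v # ps)"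
    unfolding induced_edges_def by blast
  moreover have "set (v # ps) \<subseteq> V"
  proof
    fix u assume u: "u \<in> set (v # ps)"
    show "u \<in> V"
    proof (cases "u = v \<or> u = x \<or> u = y")
      case True
      then show ?thesis using simple_graph_edgeD[OF G] x y by blast
    next
      case False
      then obtain i where i: "i < length ps" "u = ps ! i" using u by (auto simp: in_set_conv_nth)
      \<comment> \<open>Every vertex of \<open>ps\<close> except \<open>y\<close> has a successor,
        and the edge to it places the vertex in \<open>V\<close>.\<close>
      then have "i \<noteq> length ps - 1" using False ps(1,3) by (auto simp: last_conv_nth)
      then have "Suc i < length ps" using i by linarith
      then have "{u, ps ! Suc i} \<in> E" using i ps(4) by (auto simp: path_edges_def)
      then show ?thesis using simple_graph_edgeD[OF G] by blast
    qed
  qed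
  ultimately have "induced_cycle V E (v # ps)"
    using \<open>2 \<le> length ps\<close> ps by (auto simp: induced_cycle_def)
  then show ?thesis using ce xy by (intro exI[of _ "v # ps"]) (auto simp: insert_commute)
qed

text \<open>Rotated to start at \<open>v\<close>, the cycle is \<open>v\<close> followed by a path
  whose ends are the only neighbours of \<open>v\<close> on it, so these ends are \<open>x\<close>
  and \<open>y\<close> in some order.\<close>

lemma induced_cycle_imp_reach:
  assumes cyc: "induced_cycle V E cs" and "v \<in> set cs" and "x \<noteq> y"
    and sub: "path_edges [x, v, y] \<subseteq> cycle_edges cs"
  shows "reach E v x y"
proof -
  obtain k ps where rot: "rotate k cs = v # ps" using rotate_to_front[OF \<open>v \<in> set cs\<close>] .
  have cyc': "induced_cycle V E (v # ps)"
    using cyc induced_cycle_rotate[of V E k cs] rot by simp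
  have sub': "{x, v} \<in> cycle_edges (v # ps)" "{v, y} \<in> cycle_edges (v # ps)"
    using sub cycle_edges_rotate[of k cs] rot by auto
  have ps: "2 \<le> length ps" "distinct ps" "v \<notin> set ps"
    and ind: "induced_edges E (set (v # ps)) = cycle_edges (v # ps)"
    using cyc' by (auto simp: induced_cycle_def)
  define p q where "p = hd ps" and "q = last ps"
  obtain qs where qs: "ps = qs @ [q]"
    using ps(1) q_def by (metis append_butlast_last_id list.size(3) not_numeral_le_zero)
  obtain rs where rs: "ps = p # rs" using ps(1) p_def by (cases ps) auto
  have "cycle_edges (v # ps) = insert {v, p} (path_edges (ps @ [v]))"
    using rs by (simp add: cycle_edges_Cons)
  also have "path_edges (ps @ [v]) = insert {v, q} (path_edges ps)"
    using qs path_edges_append[of qs q "[v]"] by (auto simp: insert_commute)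
  finally have ce: "cycle_edges (v # ps) = {{v, p}, {v, q}} \<union> path_edges ps" by auto
  have ends: "u = p \<or> u = q" if "{v, u} \<in> cycle_edges (v # ps)" for u
  proof -
    have "{v, u} \<notin> path_edges ps" using path_edges_subset_set[of "{v, u}" ps] ps(3) by auto
    then show ?thesis using that ce by (auto simp: doubleton_eq_iff)
  qed
  have adj: "u = p \<or> u = q" if "u \<in> set ps" "{v, u} \<in> E" for u
    using that ind by (intro ends) (auto simp: induced_edges_def)
  have edges: "path_edges ps \<subseteq> E" using ce ind by (auto simp: induced_edges_def)
  have pq: "reach E v p q"
    unfolding p_def q_def using ps edges adj
    by (intro reach_along_path) (auto simp: p_def q_def)
  have "ps \<noteq> []" using rs by simp
  \<comment> \<open>The cycle may be listed in either direction, so the path is also followed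
    backwards.\<close>
  have "reach E v (hd (rev ps)) (last (rev ps))"
  proof (rule reach_along_path)
    show "u = hd (rev ps) \<or> u = last (rev ps)" if "u \<in> set (rev ps)" "{v, u} \<in> E" for u
      using adj[of u] that by (auto simp: p_def q_def hd_rev last_rev)
  qed (use ps edges \<open>ps \<noteq> []\<close> in \<open>auto simp: path_edges_rev\<close>)
  then have "reach E v q p" by (simp add: p_def q_def hd_rev last_rev)
  moreover note pq
  moreover have "x = p \<or> x = q" "y = p \<or> y = q"
    using ends sub' by (auto simp: insert_commute)
  ultimately show ?thesis using \<open>x \<noteq> y\<close> by auto
qed

text \<open>Equal or adjacent neighbours are always reachable from each other, since
  \<open>x\<close> may be expanded. Ranging over all pairs of neighbours spares the program a test
  for adjacency of \<open>x\<close> and \<open>y\<close>.\<close>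

lemma avoidable_iff_reach:
  assumes G: "simple_graph V E"
  shows "avoidable V E v \<longleftrightarrow> v \<in> V \<and> (\<forall>x y. {v, x} \<in> E \<longrightarrow> {v, y} \<in> E \<longrightarrow> reach E v x y)"
proof (intro iffI conjI allI impI)
  assume "avoidable V E v"
  then show "v \<in> V" by (simp add: avoidable_def)
  fix x y assume x: "{v, x} \<in> E" and y: "{v, y} \<in> E"
  show "reach E v x y"
  proof (cases "x = y \<or> {x, y} \<in> E")
    case True
    then show ?thesis
      using simple_graph_edgeD(3)[OF G y] by (auto intro: reach.intros)
  next
    case False
    then have "induced_path V E [x, v, y]" using x y induced_path3_iff[OF G] by blast
    then obtain cs where "induced_cycle V E cs" "set [x, v, y] \<subseteq> set cs"
      "path_edges [x, v, y] \<subseteq> cycle_edges cs"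
      using \<open>avoidable V E v\<close> unfolding avoidable_def by blast
    then show ?thesis using induced_cycle_imp_reach[of V E cs v x y] False by auto
  qed
next
  assume *: "v \<in> V \<and> (\<forall>x y. {v, x} \<in> E \<longrightarrow> {v, y} \<in> E \<longrightarrow> reach E v x y)"
  show "avoidable V E v"
    unfolding avoidable_def induced_path3_iff[OF G]
    using * reach_imp_induced_cycle[OF G] by auto
qed

subsection \<open>Weakest preconditions with running time\<close>

text \<open>Asserting that a run exists makes this total correctness. The postcondition also sees
  the time, so that results and time bounds are proved together.\<close>

definition wp :: "nat \<Rightarrow> com \<Rightarrow> state \<Rightarrow> (nat \<Rightarrow> state \<Rightarrow> bool) \<Rightarrow> bool" where
  "wp W p s Q \<longleftrightarrow> (\<exists>t s'. exec W p s t s' \<and> Q t s')"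

lemma wp_Skip [simp]: "wp W Skip s Q \<longleftrightarrow> Q 1 s"
  unfolding wp_def by (metis exec.Skip exec_SkipE)

lemma wp_SetReg [simp]:
  "wp W (SetReg r a) s Q \<longleftrightarrow> Q (1 + acost a) (s\<lparr>regs := (regs s)(r := aval W a s)\<rparr>)"
  unfolding wp_def by (metis exec.SetReg exec_SetRegE)

lemma wp_SetMem [simp]:
  "wp W (SetMem a b) s Q \<longleftrightarrow>
     Q (1 + acost a + acost b) (s\<lparr>mem := (mem s)(aval W a s := aval W b s)\<rparr>)"
  unfolding wp_def by (metis exec.SetMem exec_SetMemE)

lemma wp_Output [simp]:
  "wp W (Output a) s Q \<longleftrightarrow> Q (1 + acost a) (s\<lparr>outp := outp s @ [aval W a s]\<rparr>)"
  unfolding wp_def by (metis exec.Output exec_OutputE)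

lemma wp_Seq [simp]:
  "wp W (Seq p q) s Q \<longleftrightarrow> wp W p s (\<lambda>t s'. wp W q s' (\<lambda>t'. Q (t + t')))"
  unfolding wp_def by (metis exec.Seq exec_SeqE)

lemma wp_If [simp]:
  "wp W (If b p q) s Q \<longleftrightarrow>
     (if bval W b s then wp W p s (\<lambda>t. Q (1 + bcost b + t)) else wp W q s (\<lambda>t. Q (1 + bcost b + t)))"
    (is "_ \<longleftrightarrow> ?R")
proof
  assume "wp W (If b p q) s Q"
  then obtain t s' where "exec W (If b p q) s t s'" "Q t s'" by (auto simp: wp_def)
  then show ?R by (cases rule: exec_IfE) (auto simp: wp_def)
next
  assume ?R
  then obtain t s' where "exec W (if bval W b s then p else q) s t s'" "Q (1 + bcost b + t) s'"
    by (auto simp: wp_def split: if_splits)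
  then have "exec W (If b p q) s (1 + bcost b + t) s'"
    using exec.IfTrue[of W b s p t s' q] exec.IfFalse[of W b s q t s' p] by (simp split: if_splits)
  with \<open>Q (1 + bcost b + t) s'\<close> show "wp W (If b p q) s Q" unfolding wp_def by blast
qed

lemma wp_While:
  "wp W (While b p) s Q \<longleftrightarrow>
     (if bval W b s then wp W p s (\<lambda>t s'. wp W (While b p) s' (\<lambda>t'. Q (1 + bcost b + t + t')))
      else Q (1 + bcost b) s)" (is "_ \<longleftrightarrow> ?R")
proof
  assume "wp W (While b p) s Q"
  then obtain t s' where "exec W (While b p) s t s'" "Q t s'" by (auto simp: wp_def)
  then show ?R
    by (cases rule: exec_WhileE) (auto simp: wp_def)
next
  assume *: ?R
  show "wp W (While b p) s Q"
  proof (cases "bval W b s")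
    case True
    then obtain t s' t' s'' where "exec W p s t s'" "exec W (While b p) s' t' s''"
      "Q (1 + bcost b + t + t') s''"
      using * by (auto simp: wp_def)
    then show ?thesis using exec.WhileTrue[OF True] unfolding wp_def by blast
  next
    case False
    then have "Q (1 + bcost b) s" using * by simp
    then show ?thesis using exec.WhileFalse[OF False] unfolding wp_def by blast
  qed
qed

lemma wp_mono: "wp W p s Q \<Longrightarrow> (\<And>t s'. Q t s' \<Longrightarrow> Q' t s') \<Longrightarrow> wp W p s Q'"
  unfolding wp_def by blast

text \<open>The upper bound of the loop is the number \<open>n\<close> of vertices in register 0.\<close>

definition For :: "nat \<Rightarrow> com \<Rightarrow> com" where
  "For r p = Seq (SetReg r (Lit 0))
     (While (Less (Reg r) (Reg 0)) (Seq p (SetReg r (Plus (Reg r) (Lit 1)))))"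

text \<open>The invariant is demanded after the counter has been advanced. Each test and each
  increment costs 4, hence 8 per round; the initial assignment and the failing last test give 6. By
  \<open>n < W\<close> the counter never wraps around.\<close>

lemma wp_For:
  assumes "n < W" and "regs s 0 = n" and "r \<noteq> 0" and "I 0 (s\<lparr>regs := (regs s)(r := 0)\<rparr>)"
    and step: "\<And>i s. i < n \<Longrightarrow> I i s \<Longrightarrow> regs s r = i \<Longrightarrow> regs s 0 = n \<Longrightarrow>
      wp W p s (\<lambda>t s'. t \<le> f i \<and> regs s' r = i \<and> regs s' 0 = n \<and>
        I (Suc i) (s'\<lparr>regs := (regs s')(r := Suc i)\<rparr>))"
    and Q: "\<And>t s. t \<le> 6 + 8 * n + (\<Sum>i<n. f i) \<Longrightarrow> I n s \<Longrightarrow> regs s 0 = n \<Longrightarrow> Q t s"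
  shows "wp W (For r p) s Q"
proof -
  let ?loop = "While (Less (Reg r) (Reg 0)) (Seq p (SetReg r (Plus (Reg r) (Lit 1))))"
  have loop: "wp W ?loop s (\<lambda>t s'. t \<le> 4 + 8 * (n - i) + (\<Sum>j=i..<n. f j) \<and> I n s' \<and> regs s' 0 = n)"
    if "i \<le> n" "I i s" "regs s r = i" "regs s 0 = n" for i s
    using that
  proof (induction "n - i" arbitrary: i s)
    case 0
    then show ?case by (subst wp_While) simp
  next
    case (Suc k)
    then have i: "i < n" by simp
    let ?body = "Seq p (SetReg r (Plus (Reg r) (Lit 1)))"
    have "wp W ?body s (\<lambda>t s'. t \<le> 4 + f i \<and> I (Suc i) s' \<and> regs s' r = Suc i \<and> regs s' 0 = n)"
      unfolding wp_Seq wp_SetReg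
      by (rule wp_mono[OF step[OF i Suc.prems(2-)]]) (use i \<open>n < W\<close> \<open>r \<noteq> 0\<close> in auto)
    then have "wp W ?body s (\<lambda>t s'. wp W ?loop s' (\<lambda>t' s''.
        4 + t + t' \<le> 4 + 8 * (n - i) + (\<Sum>j=i..<n. f j) \<and> I n s'' \<and> regs s'' 0 = n))"
    proof (rule wp_mono, elim conjE)
      fix t s' assume t: "t \<le> 4 + f i" and s': "I (Suc i) s'" "regs s' r = Suc i" "regs s' 0 = n"
      have sum: "(\<Sum>j=i..<n. f j) = f i + (\<Sum>j=Suc i..<n. f j)"
        using i by (simp add: sum.atLeast_Suc_lessThan)
      show "wp W ?loop s' (\<lambda>t' s''.
          4 + t + t' \<le> 4 + 8 * (n - i) + (\<Sum>j=i..<n. f j) \<and> I n s'' \<and> regs s'' 0 = n)"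
        by (rule wp_mono[OF Suc.hyps(1)[of "Suc i"]]) (use Suc.hyps(2) i s' t sum in auto)
    qed
    moreover have "bval W (Less (Reg r) (Reg 0)) s" using Suc.prems i by simp
    moreover have "1 + bcost (Less (Reg r) (Reg 0)) = 4" by simp
    ultimately show ?case by (subst wp_While) (simp only: if_True)
  qed
  show ?thesis
    unfolding For_def wp_Seq wp_SetReg
    by (rule wp_mono[OF loop[of 0]])
      (use assms in \<open>auto intro!: Q simp: lessThan_atLeast0\<close>)
qed

subsection \<open>Invariant of the graph search\<close>

text \<open>
  \<open>M\<close> is the set of marked vertices and \<open>q\<close> the list of all vertices ever enqueued; the rows of the
  first \<open>h\<close> of them and the first \<open>z\<close> entries of the row of \<open>q ! h\<close> have been scanned. The vertex \<open>v\<close>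
  is marked from the start, so that it is never enqueued.
\<close>

definition search_inv ::
    "nat \<Rightarrow> nat set set \<Rightarrow> nat \<Rightarrow> nat \<Rightarrow> nat set \<Rightarrow> nat list \<Rightarrow> nat \<Rightarrow> nat \<Rightarrow> bool" where
  "search_inv n E v x M q h z \<longleftrightarrow>
     distinct q \<and> set q \<subseteq> M \<and> M \<subseteq> {..<n} \<and> v \<in> M \<and> v \<notin> set q \<and> x \<in> set q \<and>
     (\<forall>u\<in>set q. u = x \<or> {v, u} \<notin> E) \<and>
     (\<forall>u\<in>M. u \<noteq> v \<longrightarrow> reach E v x u) \<and>
     (\<forall>u\<in>M. u \<noteq> v \<longrightarrow> {v, u} \<notin> E \<longrightarrow> u \<in> set q) \<and>
     (\<forall>i y. i < length q \<longrightarrow> y < n \<longrightarrow> i < h \<or> i = h \<and> y < z \<longrightarrow> {q ! i, y} \<in> E \<longrightarrow> y \<in> M)"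

lemma search_inv_init:
  assumes "v < n" "x < n" "v \<noteq> x"
  shows "search_inv n E v x {v, x} [x] 0 0"
  using assms by (auto simp: search_inv_def intro: reach.start)

text \<open>Queue entries are distinct vertices. An unmarked vertex is missing from the queue, so
  there is room to enqueue it.\<close>

lemma search_inv_length:
  assumes "search_inv n E v x M q h z"
  shows "length q \<le> n" "y < n \<Longrightarrow> y \<notin> M \<Longrightarrow> length q < n"
proof -
  have q: "distinct q" "set q \<subseteq> {..<n}" "set q \<subseteq> M"
    using assms by (auto simp: search_inv_def)
  show "length q \<le> n" using card_mono[OF _ q(2)] distinct_card[OF q(1)] by simp
  assume "y < n" "y \<notin> M"
  then have "set q \<subset> {..<n}" using q by auto
  then have "card (set q) < card {..<n}" by (intro psubset_card_mono) auto
  then show "length q < n" using distinct_card[OF q(1)] by simp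
qed

lemma search_inv_skip:
  assumes "search_inv n E v x M q h z" "{q ! h, z} \<notin> E \<or> z \<in> M"
  shows "search_inv n E v x M q h (Suc z)"
  using assms unfolding search_inv_def less_Suc_eq by blast

lemma search_inv_reach:
  assumes "search_inv n E v x M q h z" "h < length q" "{q ! h, z} \<in> E" "z \<notin> M"
  shows "reach E v x z"
proof -
  have "q ! h \<in> set q" using assms(2) by simp
  moreover have "z \<noteq> v" using assms by (auto simp: search_inv_def)
  ultimately show ?thesis
    using assms unfolding search_inv_def by (metis reach.step subsetD)
qed

text \<open>A neighbour of \<open>v\<close> counts as reached but must not be expanded: it is marked
  and kept out of the queue.\<close>

lemma search_inv_mark:
  assumes inv: "search_inv n E v x M q h z" and "h < length q" "z < n" "{q ! h, z} \<in> E" "z \<notin> M"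
    and "{v, z} \<in> E"
  shows "search_inv n E v x (insert z M) q h (Suc z)"
  using inv search_inv_reach[OF inv assms(2,4,5)] assms(3,6)
  unfolding search_inv_def less_Suc_eq by blast

lemma search_inv_enqueue:
  assumes inv: "search_inv n E v x M q h z" and "h < length q" "z < n" "{q ! h, z} \<in> E" "z \<notin> M"
    and "{v, z} \<notin> E"
  shows "search_inv n E v x (insert z M) (q @ [z]) h (Suc z)"
proof -
  have "z \<notin> set q" "z \<noteq> v" using inv assms(5) by (auto simp: search_inv_def)
  moreover have "y \<in> insert z M"
    if "i < length (q @ [z])" "y < n" "i < h \<or> i = h \<and> y < Suc z" "{(q @ [z]) ! i, y} \<in> E" for i y
  proof -
    \<comment> \<open>Scanned positions are at most \<open>h\<close>, so they lie in the old queue;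
      nothing has been scanned yet for the appended \<open>z\<close>.\<close>
    have "i < length q" using that \<open>h < length q\<close> by auto
    then show ?thesis using inv that
      unfolding search_inv_def less_Suc_eq nth_append by auto
  qed
  ultimately show ?thesis
    using inv search_inv_reach[OF inv assms(2,4,5)] assms(3,6)
    unfolding search_inv_def[of _ _ _ _ "insert z M"] by (auto simp: search_inv_def)
qed

lemma search_inv_next:
  assumes "search_inv n E v x M q h n"
  shows "search_inv n E v x M q (Suc h) 0"
  using assms by (auto simp: search_inv_def less_Suc_eq)

lemma search_inv_idle:
  assumes "search_inv n E v x M q h 0" "length q \<le> h"
  shows "search_inv n E v x M q (Suc h) 0"
  using assms by (auto simp: search_inv_def)

text \<open>The queue has at most \<open>n\<close> entries, so after \<open>n\<close> rounds all
  their rows are scanned. Along \<open>reach\<close>, each expanded vertex is marked, hence queued,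
  hence all its neighbours are marked.\<close>

lemma search_inv_final:
  assumes G: "simple_graph {..<n} E" and inv: "search_inv n E v x M q n 0" and "y \<noteq> v"
  shows "y \<in> M \<longleftrightarrow> reach E v x y"
proof
  assume "y \<in> M"
  then show "reach E v x y" using inv \<open>y \<noteq> v\<close> by (auto simp: search_inv_def)
next
  assume "reach E v x y"
  then show "y \<in> M" using \<open>y \<noteq> v\<close>
  proof induction
    case start
    then show ?case using inv by (auto simp: search_inv_def)
  next
    case (step u z)
    \<comment> \<open>The vertex \<open>v\<close> is marked without being queued, so it must be
      excluded as an expanded vertex.\<close>
    have "x \<noteq> v" using inv by (auto simp: search_inv_def)
    with step.hyps(1) have "u \<noteq> v" by (cases rule: reach.cases) auto
    then have "u \<in> set q" using step inv by (auto simp: search_inv_def)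
    then obtain i where i: "i < length q" "u = q ! i" by (auto simp: in_set_conv_nth)
    moreover have "length q \<le> n" using search_inv_length(1)[OF inv] .
    moreover have "z < n" using simple_graph_edgeD(2)[OF G step.hyps(3)] by simp
    ultimately show ?case using inv step.hyps(3) unfolding search_inv_def by auto
  qed
qed

subsection \<open>The program\<close>

text \<open>
  Register 8 holds \<open>v\<close>, register 2 the neighbour \<open>x\<close> of \<open>v\<close>, register 3 the head and register 5 the
  length of the queue, register 6 the vertex being expanded, and register 7 whether \<open>v\<close> may still be
  avoidable. The marks are stored at \<open>n * n\<close> and the queue at \<open>n * n + n\<close>. The queue has at most \<open>n\<close>
  elements, hence its loop can be run exactly \<open>n\<close> times, with idle rounds at the end.
\<close>

definition adj :: "nat \<Rightarrow> nat \<Rightarrow> aexp" where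
  "adj a b = Mem (Plus (Times (Reg a) (Reg 0)) (Reg b))"

definition mark :: "nat \<Rightarrow> aexp" where
  "mark a = Plus (Times (Reg 0) (Reg 0)) (Reg a)"

definition queue :: "nat \<Rightarrow> aexp" where
  "queue a = Plus (Plus (Times (Reg 0) (Reg 0)) (Reg 0)) (Reg a)"

lemma acost_addresses [simp]: "acost (adj a b) = 6" "acost (mark a) = 5" "acost (queue a) = 7"
  by (simp_all add: adj_def mark_def queue_def)

lemma matrix_index_less:
  fixes n :: nat
  assumes "i < n" "j < n"
  shows "i * n + j < n * n"
proof -
  have "i * n + j < Suc i * n" using assms by simp
  also have "\<dots> \<le> n * n" using assms by (intro mult_right_mono) auto
  finally show ?thesis .
qed

text \<open>Only the marks need clearing between searches; the queue is emptied by resetting its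
  length in \<open>enqueue_start\<close>.\<close>

definition clear_marks :: com where
  "clear_marks = For 4 (SetMem (mark 4) (Lit 0))"

definition visit :: com where
  "visit = If (And (Eq (adj 6 4) (Lit 1)) (Eq (Mem (mark 4)) (Lit 0)))
     (Seq (SetMem (mark 4) (Lit 1))
       (If (Eq (adj 8 4) (Lit 0))
         (Seq (SetMem (queue 5) (Reg 4)) (SetReg 5 (Plus (Reg 5) (Lit 1)))) Skip)) Skip"

definition explore :: com where
  "explore = For 3 (If (Less (Reg 3) (Reg 5)) (Seq (SetReg 6 (Mem (queue 3))) (For 4 visit)) Skip)"

definition enqueue_start :: com where
  "enqueue_start = Seq (SetMem (mark 8) (Lit 1)) (Seq (SetMem (mark 2) (Lit 1))
     (Seq (SetReg 5 (Lit 0)) (Seq (SetMem (queue 5) (Reg 2)) (SetReg 5 (Lit 1)))))"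

definition check_marks :: com where
  "check_marks = For 4 (If (And (Eq (adj 8 4) (Lit 1)) (Eq (Mem (mark 4)) (Lit 0)))
     (SetReg 7 (Lit 0)) Skip)"

text \<open>The guard restricts the quadratic search to neighbours of \<open>v\<close>; other
  vertices cost constant time. This brings the degree of \<open>v\<close> into the bound.\<close>

definition test_neighbours :: com where
  "test_neighbours = For 2 (If (Eq (adj 8 2) (Lit 1))
     (Seq clear_marks (Seq enqueue_start (Seq explore check_marks))) Skip)"

definition list_avoidable :: com where
  "list_avoidable = For 8 (Seq (SetReg 7 (Lit 1)) (Seq test_neighbours
     (If (Eq (Reg 7) (Lit 1)) (Output (Reg 8)) Skip)))"

section \<open>Correctness and running time of the program\<close>

locale ram_graph =
  fixes n W :: nat and E :: "nat set set"
  assumes G: "simple_graph {..<n} E" and W: "(n + 2) ^ 2 \<le> W"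
begin

text \<open>All addresses in use lie below \<open>n * n + n + n\<close> and all counters are at most
  \<open>n\<close>, so no arithmetic wraps around modulo \<open>W\<close>.\<close>

lemma n_less_W: "n * n + n + n < W" "n < W" "1 < W" "n * n < W"
proof -
  have *: "n * n + 4 * n + 4 \<le> W" using W by (simp add: power2_eq_square algebra_simps)
  have "n \<le> n * n" by (cases n) auto
  with * show "n * n + n + n < W" "n < W" "1 < W" "n * n < W" by linarith+
qed

lemma W_mod: "0 mod W = 0" "Suc 0 mod W = Suc 0" "W \<noteq> Suc 0"
  using n_less_W by auto

lemma aval_adj:
  assumes "regs s 0 = n" "regs s a < n" "regs s b < n"
  shows "aval W (adj a b) s = mem s (regs s a * n + regs s b)"
  using matrix_index_less[OF assms(2,3)] n_less_W assms(1) by (simp add: adj_def)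

lemma aval_mark:
  assumes "regs s 0 = n" "regs s a < n"
  shows "aval W (mark a) s = n * n + regs s a"
  using n_less_W assms by (simp add: mark_def)

lemma aval_queue:
  assumes "regs s 0 = n" "regs s a < n"
  shows "aval W (queue a) s = n * n + n + regs s a"
  using n_less_W assms by (simp add: queue_def)

text \<open>Writing marks or queue entries leaves the adjacency matrix intact.\<close>

lemma matrix_index_neq:
  assumes "i < n" "j < n"
  shows "i * n + j \<noteq> n * n + k" "i * n + j \<noteq> n * n + n + k"
  using matrix_index_less[OF assms] by simp_all

lemmas addr_simps = aval_adj aval_mark aval_queue matrix_index_neq W_mod

text \<open>Collects what a search must preserve; the working registers 3 to 6 are left
  open.\<close>

definition ctx :: "nat \<Rightarrow> nat \<Rightarrow> bool \<Rightarrow> nat list \<Rightarrow> state \<Rightarrow> bool" where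
  "ctx v x ok out s \<longleftrightarrow> regs s 0 = n \<and> regs s 8 = v \<and> regs s 2 = x \<and> regs s 7 = of_bool ok \<and>
     outp s = out \<and> (\<forall>i<n. \<forall>j<n. mem s (i * n + j) = of_bool ({i, j} \<in> E))"

definition marked :: "nat set \<Rightarrow> state \<Rightarrow> bool" where
  "marked M s \<longleftrightarrow> (\<forall>i<n. mem s (n * n + i) = of_bool (i \<in> M))"

definition queued :: "nat list \<Rightarrow> state \<Rightarrow> bool" where
  "queued q s \<longleftrightarrow> regs s 5 = length q \<and> (\<forall>i<length q. mem s (n * n + n + i) = q ! i)"

lemma ctx_upd_reg [simp]:
  "r \<notin> {0, 2, 7, 8} \<Longrightarrow> ctx v x ok out (s\<lparr>regs := (regs s)(r := k)\<rparr>) = ctx v x ok out s"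
  by (simp add: ctx_def)

lemma marked_upd_reg [simp]: "marked M (s\<lparr>regs := f\<rparr>) = marked M s"
  by (simp add: marked_def)

lemma queued_upd_reg [simp]: "r \<noteq> 5 \<Longrightarrow> queued q (s\<lparr>regs := (regs s)(r := k)\<rparr>) = queued q s"
  by (simp add: queued_def)

lemma ctx_reg0: "ctx v x ok out s \<Longrightarrow> regs s 0 = n"
  by (simp add: ctx_def)

lemma wp_clear_marks:
  assumes "ctx v x ok out s"
  shows "wp W clear_marks s (\<lambda>t s'. t \<le> 6 + 15 * n \<and> ctx v x ok out s' \<and> marked {} s')"
  unfolding clear_marks_def
proof (rule wp_For[where n = n and f = "\<lambda>_. 7"
      and I = "\<lambda>i s. ctx v x ok out s \<and> (\<forall>j<i. mem s (n * n + j) = 0)"])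
  fix i s assume "i < n" "ctx v x ok out s \<and> (\<forall>j<i. mem s (n * n + j) = 0)"
    "regs s 4 = i" "regs s 0 = n"
  then show "wp W (SetMem (mark 4) (Lit 0)) s (\<lambda>t s'. t \<le> 7 \<and> regs s' 4 = i \<and> regs s' 0 = n \<and>
      ctx v x ok out (s'\<lparr>regs := (regs s')(4 := Suc i)\<rparr>) \<and>
      (\<forall>j<Suc i. mem (s'\<lparr>regs := (regs s')(4 := Suc i)\<rparr>) (n * n + j) = 0))"
    by (auto simp: ctx_def addr_simps less_Suc_eq)
qed (use assms n_less_W in \<open>auto simp: ctx_def marked_def\<close>)

lemma wp_enqueue_start:
  assumes "ctx v x ok out s" "marked {} s" "v < n" "x < n"
  shows "wp W enqueue_start s
    (\<lambda>t s'. t \<le> 27 \<and> ctx v x ok out s' \<and> marked {v, x} s' \<and> queued [x] s')"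
  using assms by (auto simp: enqueue_start_def ctx_def marked_def queued_def addr_simps)

text \<open>The three branches correspond to \<open>search_inv_skip\<close>,
  \<open>search_inv_mark\<close> and \<open>search_inv_enqueue\<close>. The last is the most
  expensive, with cost 47.\<close>

lemma wp_visit:
  assumes "ctx v x ok out s" "marked M s" "queued q s" "search_inv n E v x M q h z" "h < length q"
    "regs s 3 = h" "regs s 6 = q ! h" "regs s 4 = z" "z < n" "v < n"
  shows "wp W visit s (\<lambda>t s'. t \<le> 50 \<and> regs s' 3 = h \<and> regs s' 6 = q ! h \<and> regs s' 4 = z \<and>
    ctx v x ok out s' \<and> (\<exists>M' q'. marked M' s' \<and> queued q' s' \<and> h < length q' \<and> q' ! h = q ! h \<and>
      search_inv n E v x M' q' h (Suc z)))"
proof -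
  have "set q \<subseteq> {..<n}" using assms(4) by (auto simp: search_inv_def)
  then have qh: "q ! h < n" using nth_mem[OF assms(5)] by auto
  have regs: "regs s 0 = n" "regs s 8 = v" "regs s 5 = length q"
    using assms by (auto simp: ctx_def queued_def)
  have edge: "mem s (q ! h * n + z) = of_bool ({q ! h, z} \<in> E)" "mem s (v * n + z) = of_bool ({v, z} \<in> E)"
    "mem s (n * n + z) = of_bool (z \<in> M)"
    using assms qh by (auto simp: ctx_def marked_def)
  show ?thesis
  proof (cases "{q ! h, z} \<in> E \<and> z \<notin> M")
    case False
    then have "search_inv n E v x M q h (Suc z)"
      using search_inv_skip[OF assms(4)] by blast
    then show ?thesis
      using False assms qh by (auto simp: visit_def addr_simps regs edge)
  next
    case True
    then have len: "length q < n" using search_inv_length(2)[OF assms(4,9)] by blast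
    show ?thesis
    proof (cases "{v, z} \<in> E")
      case adjacent: True
      let ?s = "s\<lparr>mem := (mem s)(n * n + z := 1)\<rparr>"
      have "search_inv n E v x (insert z M) q h (Suc z)"
        using search_inv_mark[OF assms(4,5,9)] True adjacent by blast
      moreover have "marked (insert z M) ?s" "queued q ?s" "ctx v x ok out ?s"
        using assms by (auto simp: marked_def queued_def ctx_def addr_simps)
      ultimately show ?thesis
        using True adjacent assms qh by (auto simp: visit_def addr_simps regs edge)
    next
      case False
      let ?s = "s\<lparr>mem := (mem s)(n * n + z := 1, n * n + n + length q := z),
        regs := (regs s)(5 := Suc (length q))\<rparr>"
      have "search_inv n E v x (insert z M) (q @ [z]) h (Suc z)"
        using search_inv_enqueue[OF assms(4,5,9)] True False by blast
      moreover have "h < length (q @ [z])" "(q @ [z]) ! h = q ! h"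
        using assms(5) by (simp_all add: nth_append)
      moreover have ctx: "ctx v x ok out (s\<lparr>mem := (mem s)(n * n + z := 1, n * n + n + length q := z)\<rparr>)"
        and "marked (insert z M) ?s" "queued (q @ [z]) ?s"
        using assms len by (auto simp: marked_def queued_def ctx_def addr_simps nth_append)
      ultimately have "\<exists>M' q'. marked M' ?s \<and> queued q' ?s \<and> h < length q' \<and> q' ! h = q ! h \<and>
          search_inv n E v x M' q' h (Suc z)" by blast
      moreover have "Suc (length q) mod W = Suc (length q)" using len n_less_W by simp
      ultimately show ?thesis
        using True False assms(6-10) qh len ctx by (simp add: visit_def addr_simps regs edge)
    qed
  qed
qed

lemma wp_explore:
  assumes "ctx v x ok out s" "marked {v, x} s" "queued [x] s" "v < n" "x < n" "v \<noteq> x"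
  shows "wp W explore s (\<lambda>t s'. t \<le> 6 + 8 * n + n * (58 * n + 20) \<and> ctx v x ok out s' \<and>
    (\<exists>M. marked M s' \<and> (\<forall>y. y \<noteq> v \<longrightarrow> y \<in> M \<longleftrightarrow> reach E v x y)))"
proof -
  let ?I = "\<lambda>h s. ctx v x ok out s \<and>
    (\<exists>M q. marked M s \<and> queued q s \<and> search_inv n E v x M q h 0)"
  \<comment> \<open>The queue may grow during the scan of a row, but its entry at \<open>h\<close>
    stays the same; the name \<open>u\<close> makes this part of the invariant.\<close>
  let ?J = "\<lambda>h u z s. ctx v x ok out s \<and> regs s 3 = h \<and> regs s 6 = u \<and>
    (\<exists>M q. marked M s \<and> queued q s \<and> h < length q \<and> q ! h = u \<and> search_inv n E v x M q h z)"
  have inner: "wp W (For 4 visit) s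
      (\<lambda>t s'. t \<le> 6 + 58 * n \<and> regs s' 3 = h \<and> ?I (Suc h) (s'\<lparr>regs := (regs s')(3 := Suc h)\<rparr>))"
    if "?J h u 0 s" for s h u
  proof (rule wp_For[where n = n and f = "\<lambda>_. 50" and I = "?J h u"])
    show "?J h u 0 (s\<lparr>regs := (regs s)(4 := 0)\<rparr>)"
      using that by auto
    fix z s assume z: "z < n" and "?J h u z s" and "regs s 4 = z"
    then obtain M q where *: "ctx v x ok out s" "marked M s" "queued q s"
      "search_inv n E v x M q h z" "h < length q" "regs s 3 = h" "regs s 6 = q ! h" "q ! h = u"
      by auto
    show "wp W visit s (\<lambda>t s'. t \<le> 50 \<and> regs s' 4 = z \<and> regs s' 0 = n \<and>
        ?J h u (Suc z) (s'\<lparr>regs := (regs s')(4 := Suc z)\<rparr>))"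
      by (rule wp_mono[OF wp_visit[OF *(1-7) \<open>regs s 4 = z\<close> z \<open>v < n\<close>]])
        (use *(8) in \<open>auto simp: ctx_reg0\<close>)
  next
    fix t s assume "t \<le> 6 + 8 * n + (\<Sum>i<n. 50)" "?J h u n s" "regs s 0 = n"
    then show "t \<le> 6 + 58 * n \<and> regs s 3 = h \<and> ?I (Suc h) (s\<lparr>regs := (regs s)(3 := Suc h)\<rparr>)"
      by (auto dest: search_inv_next)
  qed (use that n_less_W in \<open>auto simp: ctx_reg0\<close>)
  show ?thesis
    unfolding explore_def
  \<comment> \<open>The guard and the loading of register 6 cost 13, and the scan of a row at most
    \<open>6 + 58 * n\<close>.\<close>
  proof (rule wp_For[where n = n and f = "\<lambda>_. 58 * n + 20" and I = ?I])
    have "search_inv n E v x {v, x} [x] 0 0" using search_inv_init assms by blast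
    then show "?I 0 (s\<lparr>regs := (regs s)(3 := 0)\<rparr>)"
      using assms by auto
    fix h s assume h: "h < n" and "?I h s" and s: "regs s 3 = h" "regs s 0 = n"
    then obtain M q where *: "ctx v x ok out s" "marked M s" "queued q s"
      "search_inv n E v x M q h 0" by blast
    have len: "regs s 5 = length q" using * by (simp add: queued_def)
    show "wp W (If (Less (Reg 3) (Reg 5)) (Seq (SetReg 6 (Mem (queue 3))) (For 4 visit)) Skip) s
      (\<lambda>t s'. t \<le> 58 * n + 20 \<and> regs s' 3 = h \<and> regs s' 0 = n \<and>
        ?I (Suc h) (s'\<lparr>regs := (regs s')(3 := Suc h)\<rparr>))"
    proof (cases "h < length q")
      case True
      let ?s = "s\<lparr>regs := (regs s)(6 := q ! h)\<rparr>"
      have "aval W (Mem (queue 3)) s = q ! h"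
        using * s h True by (simp add: addr_simps queued_def)
      moreover have "?J h (q ! h) 0 ?s"
        using * s True by auto
      from inner[OF this] have "wp W (For 4 visit) ?s (\<lambda>t s'. 13 + t \<le> 58 * n + 20 \<and> regs s' 3 = h \<and>
          regs s' 0 = n \<and> ?I (Suc h) (s'\<lparr>regs := (regs s')(3 := Suc h)\<rparr>))"
        by (rule wp_mono) (auto simp: ctx_reg0)
      ultimately show ?thesis using True by (simp add: s len)
    next
      case False
      then have "search_inv n E v x M q (Suc h) 0" using * by (simp add: search_inv_idle)
      then show ?thesis using * False s len by auto
    qed
  next
    fix t s assume t: "t \<le> 6 + 8 * n + (\<Sum>i<n. 58 * n + 20)" and "?I n s"
    then obtain M q where "ctx v x ok out s" "marked M s" "search_inv n E v x M q n 0" by blast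
    then show "t \<le> 6 + 8 * n + n * (58 * n + 20) \<and> ctx v x ok out s \<and>
      (\<exists>M. marked M s \<and> (\<forall>y. y \<noteq> v \<longrightarrow> y \<in> M \<longleftrightarrow> reach E v x y))"
      using t search_inv_final[OF G] by auto
  qed (use assms n_less_W in \<open>auto simp: ctx_reg0\<close>)
qed

lemma wp_check_marks:
  assumes "ctx v x ok out s" "marked M s" "v < n"
  shows "wp W check_marks s (\<lambda>t s'. t \<le> 6 + 28 * n \<and>
    ctx v x (ok \<and> (\<forall>y<n. {v, y} \<in> E \<longrightarrow> y \<in> M)) out s')"
  unfolding check_marks_def
proof (rule wp_For[where n = n and f = "\<lambda>_. 20"
      and I = "\<lambda>i s. ctx v x (ok \<and> (\<forall>y<i. {v, y} \<in> E \<longrightarrow> y \<in> M)) out s \<and> marked M s"])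
  fix i s assume "i < n" "ctx v x (ok \<and> (\<forall>y<i. {v, y} \<in> E \<longrightarrow> y \<in> M)) out s \<and> marked M s"
    "regs s 4 = i" "regs s 0 = n"
  then show "wp W (If (And (Eq (adj 8 4) (Lit 1)) (Eq (Mem (mark 4)) (Lit 0))) (SetReg 7 (Lit 0)) Skip) s
      (\<lambda>t s'. t \<le> 20 \<and> regs s' 4 = i \<and> regs s' 0 = n \<and>
        ctx v x (ok \<and> (\<forall>y<Suc i. {v, y} \<in> E \<longrightarrow> y \<in> M)) out (s'\<lparr>regs := (regs s')(4 := Suc i)\<rparr>) \<and>
        marked M (s'\<lparr>regs := (regs s')(4 := Suc i)\<rparr>))"
    using \<open>v < n\<close> by (auto simp: ctx_def marked_def addr_simps less_Suc_eq)
qed (use assms n_less_W in \<open>auto simp: ctx_def marked_def\<close>)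

text \<open>Sum of the bounds for the four phases of one search, with the constant rounded
  up.\<close>

definition search_cost :: nat where
  "search_cost = 58 * n ^ 2 + 71 * n + 60"

lemma wp_test_neighbours:
  assumes "ctx v x0 True out s" "v < n"
  shows "wp W test_neighbours s (\<lambda>t s'.
    t \<le> 6 + 18 * n + card {x. {v, x} \<in> E} * search_cost \<and>
    (\<exists>x. ctx v x (avoidable {..<n} E v) out s'))"
proof -
  let ?ok = "\<lambda>i. \<forall>x<i. {v, x} \<in> E \<longrightarrow> (\<forall>y<n. {v, y} \<in> E \<longrightarrow> reach E v x y)"
  let ?f = "\<lambda>x. 10 + of_bool ({v, x} \<in> E) * search_cost"
  have nbr: "y < n \<and> y \<noteq> v" if "{v, y} \<in> E" for y
    using simple_graph_edgeD[OF G that] by auto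
  have ok: "avoidable {..<n} E v \<longleftrightarrow> ?ok n"
    unfolding avoidable_iff_reach[OF G] using \<open>v < n\<close> nbr by auto
  have nbrs: "{..<n} \<inter> {x. {v, x} \<in> E} = {x. {v, x} \<in> E}" using nbr by auto
  show ?thesis
    unfolding test_neighbours_def
  \<comment> \<open>The loop counter is register 2, which \<open>ctx\<close> describes, so the
    invariant passes \<open>i\<close> as the current neighbour.\<close>
  proof (rule wp_For[where n = n and f = ?f and I = "\<lambda>i s. ctx v i (?ok i) out s"])
    fix x s assume x: "x < n" and s: "ctx v x (?ok x) out s"
    let ?Q = "\<lambda>t s'. t \<le> ?f x \<and> regs s' 2 = x \<and> regs s' 0 = n \<and>
      ctx v (Suc x) (?ok (Suc x)) out (s'\<lparr>regs := (regs s')(2 := Suc x)\<rparr>)"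
    have cond: "bval W (Eq (adj 8 2) (Lit 1)) s \<longleftrightarrow> {v, x} \<in> E"
      using s x \<open>v < n\<close> by (auto simp: ctx_def addr_simps)
    show "wp W (If (Eq (adj 8 2) (Lit 1))
        (Seq clear_marks (Seq enqueue_start (Seq explore check_marks))) Skip) s ?Q"
    proof (cases "{v, x} \<in> E")
      case False
      then show ?thesis using s by (simp only: wp_If cond) (auto simp: ctx_def less_Suc_eq)
    next
      case True
      then have "v \<noteq> x" using nbr by auto
      let ?T = "9 + (6 + 15 * n) + 27 + (6 + 8 * n + n * (58 * n + 20)) + (6 + 28 * n)"
      have "wp W (Seq clear_marks (Seq enqueue_start (Seq explore check_marks))) s
          (\<lambda>t s'. 9 + t \<le> ?T \<and> ctx v x (?ok (Suc x)) out s')"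
        unfolding wp_Seq
      proof (rule wp_mono[OF wp_clear_marks[OF s]], elim conjE)
        fix t1 s1 assume t1: "t1 \<le> 6 + 15 * n" and s1: "ctx v x (?ok x) out s1" "marked {} s1"
        show "wp W enqueue_start s1 (\<lambda>t2 s2. wp W explore s2 (\<lambda>t3 s3. wp W check_marks s3
            (\<lambda>t4 s4. 9 + (t1 + (t2 + (t3 + t4))) \<le> ?T \<and> ctx v x (?ok (Suc x)) out s4)))"
        proof (rule wp_mono[OF wp_enqueue_start[OF s1 \<open>v < n\<close> x]], elim conjE)
          fix t2 :: nat and s2 assume t2: "t2 \<le> 27"
            and s2: "ctx v x (?ok x) out s2" "marked {v, x} s2" "queued [x] s2"
          show "wp W explore s2 (\<lambda>t3 s3. wp W check_marks s3
            (\<lambda>t4 s4. 9 + (t1 + (t2 + (t3 + t4))) \<le> ?T \<and> ctx v x (?ok (Suc x)) out s4))"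
          proof (rule wp_mono[OF wp_explore[OF s2 \<open>v < n\<close> x \<open>v \<noteq> x\<close>]], elim conjE exE)
            fix t3 s3 M assume t3: "t3 \<le> 6 + 8 * n + n * (58 * n + 20)"
              and s3: "ctx v x (?ok x) out s3" "marked M s3"
              and M: "\<forall>y. y \<noteq> v \<longrightarrow> (y \<in> M) = reach E v x y"
            \<comment> \<open>Neighbours of \<open>v\<close> differ from \<open>v\<close>, so for
              them being marked is the same as being reachable, and the check extends
              \<open>?ok\<close> by one vertex.\<close>
            have "(?ok x \<and> (\<forall>y<n. {v, y} \<in> E \<longrightarrow> y \<in> M)) = ?ok (Suc x)"
              using M nbr True by (auto simp: less_Suc_eq)
            then show "wp W check_marks s3
              (\<lambda>t4 s4. 9 + (t1 + (t2 + (t3 + t4))) \<le> ?T \<and> ctx v x (?ok (Suc x)) out s4)"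
              using wp_mono[OF wp_check_marks[OF s3 \<open>v < n\<close>]] t1 t2 t3 by simp
          qed
        qed
      qed
      moreover have "?T \<le> ?f x"
        using True by (simp add: search_cost_def power2_eq_square algebra_simps)
      ultimately show ?thesis
        using True by (simp only: wp_If cond if_True) (erule wp_mono, auto simp: ctx_def)
    qed
  next
    fix t s assume "t \<le> 6 + 8 * n + (\<Sum>i<n. ?f i)" "ctx v n (?ok n) out s"
    moreover have "(\<Sum>i<n. ?f i) = 10 * n + card {x. {v, x} \<in> E} * search_cost"
      by (simp add: sum.distrib sum_distrib_right[symmetric] nbrs)
    ultimately show "t \<le> 6 + 18 * n + card {x. {v, x} \<in> E} * search_cost \<and>
        (\<exists>x. ctx v x (avoidable {..<n} E v) out s)"
      unfolding ok by auto
  qed (use assms n_less_W in \<open>auto simp: ctx_def\<close>)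
qed

lemma wp_list_avoidable:
  "wp W list_avoidable (input_state n E) (\<lambda>t s.
    t \<le> 6 + 22 * n + 18 * n ^ 2 + (\<Sum>v<n. card {x. {v, x} \<in> E}) * search_cost \<and>
    outp s = filter (avoidable {..<n} E) [0..<n])"
proof -
  \<comment> \<open>Registers 2 and 7 vary from round to round and are left open; setting register 7
    to 1 restores \<open>ctx\<close> with an undecided \<open>v\<close>.\<close>
  let ?I = "\<lambda>v s. regs s 8 = v \<and> (\<forall>i<n. \<forall>j<n. mem s (i * n + j) = of_bool ({i, j} \<in> E)) \<and>
    outp s = filter (avoidable {..<n} E) [0..<v]"
  let ?f = "\<lambda>v. 14 + 18 * n + card {x. {v, x} \<in> E} * search_cost"
  show ?thesis
    unfolding list_avoidable_def
  proof (rule wp_For[where n = n and f = ?f and I = ?I])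
    show "?I 0 ((input_state n E)\<lparr>regs := (regs (input_state n E))(8 := 0)\<rparr>)"
      using matrix_index_less[of _ n] by (auto simp: input_state_def)
    fix v and s :: state assume v: "v < n" and "?I v s" and s: "regs s 8 = v" "regs s 0 = n"
    let ?out = "filter (avoidable {..<n} E) [0..<v]"
    let ?s = "s\<lparr>regs := (regs s)(7 := Suc 0)\<rparr>"
    let ?Q = "\<lambda>t s'. t \<le> ?f v \<and> regs s' 8 = v \<and> regs s' 0 = n \<and>
      ?I (Suc v) (s'\<lparr>regs := (regs s')(8 := Suc v)\<rparr>)"
    have "ctx v (regs s 2) True ?out ?s" using \<open>?I v s\<close> s by (auto simp: ctx_def)
    from wp_test_neighbours[OF this v]
    have "wp W test_neighbours ?s
      (\<lambda>t s'. wp W (If (Eq (Reg 7) (Lit 1)) (Output (Reg 8)) Skip) s' (\<lambda>t'. ?Q (2 + (t + t'))))"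
      by (rule wp_mono) (auto simp: ctx_def W_mod)
    then show "wp W (Seq (SetReg 7 (Lit 1)) (Seq test_neighbours
        (If (Eq (Reg 7) (Lit 1)) (Output (Reg 8)) Skip))) s ?Q"
      unfolding wp_Seq wp_SetReg by (simp add: W_mod)
  next
    fix t and s :: state assume "t \<le> 6 + 8 * n + (\<Sum>v<n. ?f v)" "?I n s"
    moreover have "(\<Sum>v<n. ?f v) =
        14 * n + 18 * n ^ 2 + (\<Sum>v<n. card {x. {v, x} \<in> E}) * search_cost"
      by (simp add: sum.distrib sum_distrib_right[symmetric] power2_eq_square distrib_left)
    ultimately show "t \<le> 6 + 22 * n + 18 * n ^ 2 + (\<Sum>v<n. card {x. {v, x} \<in> E}) * search_cost \<and>
        outp s = filter (avoidable {..<n} E) [0..<n]"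
      by simp
  qed (use n_less_W in \<open>auto simp: input_state_def\<close>)
qed

end

section \<open>Sum of degrees and the final time bound\<close>

lemma sum_degrees_le:
  fixes n :: nat
  assumes G: "simple_graph {..<n} E"
  shows "(\<Sum>v<n. card {x. {v, x} \<in> E}) \<le> 2 * card E"
proof -
  have nbr: "{x. {v, x} \<in> E} \<subseteq> {..<n}" for v using simple_graph_edgeD[OF G] by auto
  let ?D = "SIGMA v:{..<n}. {x. {v, x} \<in> E}"
  \<comment> \<open>Each edge comes from two ordered pairs, told apart by the orientation bit
    \<open>v < x\<close>.\<close>
  let ?f = "\<lambda>(v, x). ({v, x}, v < x)"
  have "finite E" using G by (auto simp: simple_graph_def intro: finite_subset[of E "Pow {..<n}"])
  have "inj_on ?f ?D" by (auto simp: inj_on_def doubleton_eq_iff)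
  moreover have "?f ` ?D \<subseteq> E \<times> UNIV" by auto
  ultimately have "card ?D \<le> card (E \<times> (UNIV :: bool set))"
    using \<open>finite E\<close> by (intro card_inj_on_le) auto
  moreover have "card ?D = (\<Sum>v<n. card {x. {v, x} \<in> E})"
    using finite_subset[OF nbr] by (intro card_SigmaI) auto
  ultimately show ?thesis by (simp add: card_cartesian_product)
qed

theorem theorem16:
  "\<exists>(p :: com) (c :: nat) (k :: nat). \<forall>(n :: nat) (E :: nat set set) (w :: nat).
     simple_graph {..<n} E \<and> (n + 2) ^ k \<le> 2 ^ w \<longrightarrow>
       (\<exists>t s. exec (2 ^ w) p (input_state n E) t s \<and>
              distinct (outp s) \<and> set (outp s) = {v. avoidable {..<n} E v} \<and>
              (card E \<ge> 1 \<longrightarrow> t \<le> c * (n ^ 2 * card E)))"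
\<comment> \<open>The constant is \<open>46 + 378\<close>, with \<open>46 = 6 + 22 + 18\<close> from
  the outer loops and \<open>378 = 2 * 189\<close>, where \<open>189 = 58 + 71 + 60\<close> comes
  from \<open>search_cost\<close> and 2 from the sum of degrees.\<close>
proof (rule exI[of _ list_avoidable], rule exI[of _ 424], rule exI[of _ 2],
    intro allI impI, elim conjE)
  fix n :: nat and E :: "nat set set" and w :: nat
  assume G: "simple_graph {..<n} E" and W: "(n + 2) ^ 2 \<le> (2 :: nat) ^ w"
  interpret ram_graph n "2 ^ w" E using G W by unfold_locales
  obtain t s where run: "exec (2 ^ w) list_avoidable (input_state n E) t s"
    and t: "t \<le> 6 + 22 * n + 18 * n ^ 2 + (\<Sum>v<n. card {x. {v, x} \<in> E}) * search_cost"
    and out: "outp s = filter (avoidable {..<n} E) [0..<n]"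
    using wp_list_avoidable by (auto simp: wp_def)
  have "t \<le> 424 * (n ^ 2 * card E)" if m: "1 \<le> card E"
  proof -
    \<comment> \<open>An edge forces \<open>n\<close> to be positive, so lower powers of
      \<open>n\<close> are absorbed into \<open>n ^ 2\<close>.\<close>
    obtain e where "e \<in> E" using m by fastforce
    then have "e \<subseteq> {..<n}" "card e = 2" using G by (auto simp: simple_graph_def)
    then have "n \<noteq> 0" by (cases "n = 0") auto
    then have n: "n \<le> n ^ 2" "1 \<le> n ^ 2" by (auto simp: power2_eq_square)
    have nm: "n ^ 2 \<le> n ^ 2 * card E" using m by simp
    have "search_cost \<le> 189 * n ^ 2" unfolding search_cost_def using n by linarith
    then have "(\<Sum>v<n. card {x. {v, x} \<in> E}) * search_cost \<le> 2 * card E * (189 * n ^ 2)"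
      using sum_degrees_le[OF G] by (rule mult_le_mono[rotated])
    also have "\<dots> = 378 * (n ^ 2 * card E)" by simp
    finally show ?thesis using t n nm by linarith
  qed
  moreover have "set (outp s) = {v. avoidable {..<n} E v}"
    unfolding out by (auto simp: avoidable_def)
  moreover have "distinct (outp s)" unfolding out by simp
  ultimately show "\<exists>t s. exec (2 ^ w) list_avoidable (input_state n E) t s \<and>
      distinct (outp s) \<and> set (outp s) = {v. avoidable {..<n} E v} \<and>
      (card E \<ge> 1 \<longrightarrow> t \<le> 424 * (n ^ 2 * card E))"
    using run by blast
qed

end
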